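(* Let $p \geq 3$ be a fixed integer. Then there is a sequence of edge-colorings $\chi_n$ of the complete graphs $K_n$ ($n = 1,2,\dots$) such that: (i) $\chi_n$ uses at most $n^{o(1)}$ colors (as $n \to \infty$, with $p$ fixed); (ii) $\chi_n$ is a $(p,p-1)$-coloring, i.e. every $p$-clique of $K_n$ contains edges of at least $p-1$ distinct colors; (iii) every $p$-clique of $K_n$ whose edges receive exactly $p-1$ distinct colors under $\chi_n$ is isomorphic, as an edge-colored graph, to an edge-colored $p$-clique with a leftover structure; equivalently, its vertex set has a leftover structure under $\chi_n$.
   Context: For an edge-coloring $f: E(K_n)\to C$ and a vertex set $A$, write $f(A)$ for the set of colors appearing on edges with both endpoints in $A$. A subset $S \subseteq V(K_n)$ has a leftover structure under $f$ if either $|S|=1$, or there is a partition $S = A \cup B$ into nonempty sets $A$, $B$ such that: $A$ and $B$ each have a leftover structure under $f$; $f(A) \cap f(B) = \emptyset$; and there is a color $\alpha \in C$ with $f(a,b) = \alpha$ for all $a \in A$, $b \in B$, and $\alpha \notin f(A)$, $\alpha \notin f(B)$. (Equivalently, a leftover $p$-clique is obtained from a leftover $(p-1)$-clique by duplicating a vertex $x$ into $x,x'$, giving $xx'$ a new color and giving each $x'y$ the color of $xy$.) A $(p,q)$-coloring of a graph is an edge-coloring in which every $p$-clique receives at least $q$ distinct colors. *)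

theory Defs
  imports Complex_Main
begin

definition colors_in :: "('v set \<Rightarrow> 'c) \<Rightarrow> 'v set \<Rightarrow> 'c set" where
  "colors_in f A = {f {a, b} | a b. a \<in> A \<and> b \<in> A \<and> a \<noteq> b}"

inductive leftover :: "('v set \<Rightarrow> 'c) \<Rightarrow> 'v set \<Rightarrow> bool" for f where
  single: "leftover f {x}"
| split: "\<lbrakk> leftover f A; leftover f B; A \<noteq> {}; B \<noteq> {}; A \<inter> B = {};
           colors_in f A \<inter> colors_in f B = {};
           \<forall>a\<in>A. \<forall>b\<in>B. f {a, b} = \<alpha>;
           \<alpha> \<notin> colors_in f A; \<alpha> \<notin> colors_in f B \<rbrakk> \<Longrightarrow> leftover f (A \<union> B)"

end

(*
  Vertices are bit strings, read from the low bit. At a scale (a, b) with a dvd b, cut the positions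
  into blocks of length b. The colour of xy records, for every block in which x and y differ, the
  first position i of difference there, the bits of x in the current block of length a before i, and
  whether the difference at i has the same direction as the first difference overall. There are few
  blocks, and each stores only about a bits, so there are few colours when a is much smaller than b;
  the colouring for n is the product over k < K of those for the scales (B^k, B^(k+1)), where
  2^(B^K) is about n.

  For a p-set S, call a scale separated if any two nodes of the prefix tree of S that branch at the
  same position i and agree on the current a-block also agree on the current b-block. A pair of
  branching nodes spoils at most one scale, so a constant K leaves a separated one. There one
  inducts on the string length: passing from prefixes V of length j to prefixes W of length j + 1
  doubles the elements of a set D. If D splits into classes D_l by their labels in the a-block, then
  each class brings one new colour for the doubled pairs, and every colour inside D_l occurs in W
  bare and with each of the two directions at j. So W has at least
  |colours V| + sum_l (1 + 2 |colours D_l|) colours. Inductively this is at least |W| - 1, and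
  equality forces all D_l to be singletons, so that W arises from V by doubling vertices with new
  colours, which preserves the leftover structure.
*)

theory Submission
  imports Defs "HOL-Library.FuncSet"
begin

section \<open>Colour sets and transfer of leftover structures\<close>

lemma colors_in_mono: "A \<subseteq> B \<Longrightarrow> colors_in f A \<subseteq> colors_in f B"
  unfolding colors_in_def by blast

lemma colors_inI: "a \<in> A \<Longrightarrow> b \<in> A \<Longrightarrow> a \<noteq> b \<Longrightarrow> f {a, b} \<in> colors_in f A"
  unfolding colors_in_def by blast

lemma colors_inE:
  assumes "c \<in> colors_in f A"
  obtains a b where "a \<in> A" "b \<in> A" "a \<noteq> b" "c = f {a, b}"
  using assms unfolding colors_in_def by blast

lemma colors_in_singleton [simp]: "colors_in f {x} = {}"
  unfolding colors_in_def by blast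

lemma finite_colors_in [simp]: "finite A \<Longrightarrow> finite (colors_in f A)"
proof -
  assume "finite A"
  moreover have "colors_in f A \<subseteq> (\<lambda>(a, b). f {a, b}) ` (A \<times> A)"
    unfolding colors_in_def by auto
  ultimately show ?thesis by (meson finite_SigmaI finite_imageI finite_subset)
qed

lemma colors_in_transfer:
  assumes "\<And>a b. a \<in> A \<Longrightarrow> b \<in> A \<Longrightarrow> a \<noteq> b \<Longrightarrow> f {a, b} = \<phi> (g {a, b})"
  shows "colors_in f A = \<phi> ` colors_in g A"
  using assms unfolding colors_in_def by (auto simp: image_iff) metis+

text \<open>On \<open>A\<close> the two colourings induce the same partition of the edges, because
  \<open>\<phi>\<close> merges no colours there, and being leftover depends only on that partition.
  It serves to pass from one coordinate of a product colouring to the product, and from colours to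
  their numerical codes.\<close>

lemma leftover_refine:
  assumes "leftover f A"
    and "\<And>a b. a \<in> A \<Longrightarrow> b \<in> A \<Longrightarrow> a \<noteq> b \<Longrightarrow> f {a, b} = \<phi> (g {a, b})"
    and "inj_on \<phi> (colors_in g A)"
  shows "leftover g A"
  using assms
proof (induction rule: leftover.induct)
  case (single x)
  show ?case by (rule leftover.single)
next
  case (split A B \<alpha>)
  have A: "leftover g A" and B: "leftover g B"
    using split.IH split.prems inj_on_subset[OF split.prems(2) colors_in_mono] by auto
  have cA: "colors_in f A = \<phi> ` colors_in g A" and cB: "colors_in f B = \<phi> ` colors_in g B"
    using split.prems(1) by (auto intro!: colors_in_transfer)
  obtain a b where ab: "a \<in> A" "b \<in> B" using split.hyps by blast
  have mem: "g {x, y} \<in> colors_in g (A \<union> B)" if "x \<in> A" "y \<in> B" for x y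
    using that split.hyps by (intro colors_inI) auto
  have \<alpha>: "\<alpha> = \<phi> (g {x, y})" if "x \<in> A" "y \<in> B" for x y
    using split.prems(1)[of x y] split.hyps that by force
  have eq: "g {x, y} = g {a, b}" if "x \<in> A" "y \<in> B" for x y
    using inj_onD[OF split.prems(2)] mem \<alpha> that ab by metis
  show ?case
  proof (rule leftover.split[OF A B, where \<alpha> = "g {a, b}"])
    show "colors_in g A \<inter> colors_in g B = {}"
      using split.hyps cA cB by blast
    show "g {a, b} \<notin> colors_in g A" "g {a, b} \<notin> colors_in g B"
      using split.hyps cA cB \<alpha>[OF ab] by blast+
  qed (use split.hyps eq in auto)
qed

text \<open>Vertex duplication done for many vertices at once: the fibres of \<open>\<pi>\<close>
  have at most two points, \<open>h\<close> carries the old colours over, and \<open>N\<close> gives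
  each two-point fibre a fresh colour of its own. The derivation of \<open>leftover g A\<close>
  lifts node by node, a leaf becoming one or two points; hence the claim about preimages of
  arbitrary \<open>A\<close>.\<close>

lemma leftover_blowup:
  fixes f :: "'v set \<Rightarrow> 'c" and g :: "'w set \<Rightarrow> 'd"
  assumes "leftover g A" "A \<subseteq> \<pi> ` W"
    and old: "\<And>x y. x \<in> W \<Longrightarrow> y \<in> W \<Longrightarrow> \<pi> x \<noteq> \<pi> y \<Longrightarrow> f {x, y} = h (g {\<pi> x, \<pi> y})"
    and inj: "inj_on h (colors_in g (\<pi> ` W))"
    and new: "\<And>x y. x \<in> W \<Longrightarrow> y \<in> W \<Longrightarrow> \<pi> x = \<pi> y \<Longrightarrow> x \<noteq> y \<Longrightarrow> f {x, y} = N (\<pi> x)"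
    and newinj: "inj_on N D"
    and D: "\<And>x y. x \<in> W \<Longrightarrow> y \<in> W \<Longrightarrow> \<pi> x = \<pi> y \<Longrightarrow> x \<noteq> y \<Longrightarrow> \<pi> x \<in> D"
    and fresh: "\<And>d. d \<in> D \<Longrightarrow> N d \<notin> h ` colors_in g (\<pi> ` W)"
    and two: "\<And>x y z. x \<in> W \<Longrightarrow> y \<in> W \<Longrightarrow> z \<in> W \<Longrightarrow> \<pi> x = \<pi> y \<Longrightarrow> \<pi> y = \<pi> z \<Longrightarrow>
       x = y \<or> y = z \<or> x = z"
  shows "leftover f {x \<in> W. \<pi> x \<in> A}"
  using assms(1,2)
proof (induction rule: leftover.induct)
  case (single v)
  then obtain x where x: "x \<in> W" "\<pi> x = v" by auto
  show ?case
  proof (cases "\<exists>y\<in>W. \<pi> y = v \<and> y \<noteq> x")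
    case True
    then obtain y where y: "y \<in> W" "\<pi> y = v" "y \<noteq> x" by auto
    have "z = x \<or> z = y" if "z \<in> W" "\<pi> z = v" for z
      using x y that two[of x y z] by auto
    then have "{x \<in> W. \<pi> x \<in> {v}} = {x} \<union> {y}"
      using x y by blast
    moreover have "leftover f ({x} \<union> {y})"
      by (rule leftover.split[where \<alpha> = "f {x, y}"]) (use y in \<open>auto intro: leftover.single\<close>)
    ultimately show ?thesis by simp
  next
    case False
    then have "{x \<in> W. \<pi> x \<in> {v}} = {x}" using x by blast
    then show ?thesis by (simp add: leftover.single)
  qed
next
  case (split A B \<alpha>)
  let ?P = "\<lambda>A. {x \<in> W. \<pi> x \<in> A}"
  have sub: "A \<subseteq> \<pi> ` W" "B \<subseteq> \<pi> ` W" using split.prems by auto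
  \<comment> \<open>An edge over \<open>X\<close> either projects to an edge of \<open>X\<close> or
    lies in a fibre.\<close>
  have cols: "colors_in f (?P X) \<subseteq> h ` colors_in g X \<union> N ` (X \<inter> D)" for X
  proof
    fix c assume "c \<in> colors_in f (?P X)"
    then obtain x y where xy: "x \<in> ?P X" "y \<in> ?P X" "x \<noteq> y" "c = f {x, y}"
      by (rule colors_inE)
    show "c \<in> h ` colors_in g X \<union> N ` (X \<inter> D)"
    proof (cases "\<pi> x = \<pi> y")
      case True
      then show ?thesis using xy new[of x y] D[of x y] by auto
    next
      case False
      then show ?thesis using xy old[of x y] colors_inI[of "\<pi> x" X "\<pi> y" g] by auto
    qed
  qed
  have sA: "colors_in g A \<subseteq> colors_in g (\<pi> ` W)" and sB: "colors_in g B \<subseteq> colors_in g (\<pi> ` W)"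
    using sub colors_in_mono by metis+
  obtain a b where ab: "a \<in> A" "b \<in> B" using split.hyps by blast
  have "a \<noteq> b" using ab split.hyps by auto
  have \<alpha>: "\<alpha> \<in> colors_in g (\<pi> ` W)"
  proof -
    have "a \<in> \<pi> ` W" "b \<in> \<pi> ` W" "g {a, b} = \<alpha>" using ab sub split.hyps(7) by blast+
    then show ?thesis using colors_inI \<open>a \<noteq> b\<close> by metis
  qed
  have hd: "h ` colors_in g A \<inter> h ` colors_in g B = {}"
    using inj_on_image_Int[OF inj sA sB] split.hyps by simp
  have Nd: "N ` (A \<inter> D) \<inter> N ` (B \<inter> D) = {}"
    using newinj split.hyps(5) unfolding inj_on_def by fastforce
  have ha: "h \<alpha> \<notin> h ` colors_in g A" "h \<alpha> \<notin> h ` colors_in g B"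
    using inj_on_image_mem_iff[OF inj \<alpha>] sA sB split.hyps by auto
  have "leftover f (?P A \<union> ?P B)"
  proof (rule leftover.split[where \<alpha> = "h \<alpha>"])
    show "leftover f (?P A)" "leftover f (?P B)" using split.IH sub by auto
    show "colors_in f (?P A) \<inter> colors_in f (?P B) = {}"
    proof -
      have "h ` colors_in g X \<inter> N ` (Y \<inter> D) = {}" if X: "X \<subseteq> \<pi> ` W" for X Y
      proof (rule equals0I)
        fix c assume "c \<in> h ` colors_in g X \<inter> N ` (Y \<inter> D)"
        then obtain d where "d \<in> D" "c = N d" "c \<in> h ` colors_in g (\<pi> ` W)"
          using colors_in_mono[OF X, of g] by blast
        then show False using fresh by blast
      qed
      then have "(h ` colors_in g A \<union> N ` (A \<inter> D)) \<inter> (h ` colors_in g B \<union> N ` (B \<inter> D)) = {}"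
        using hd Nd sub by (simp add: Int_Un_distrib Int_Un_distrib2 Int_commute)
      then show ?thesis using cols[of A] cols[of B] by (meson disjoint_iff subsetD)
    qed
    show "\<forall>x\<in>?P A. \<forall>y\<in>?P B. f {x, y} = h \<alpha>"
    proof (intro ballI)
      fix x y assume xy: "x \<in> ?P A" "y \<in> ?P B"
      then have "\<pi> x \<noteq> \<pi> y" using split.hyps by auto
      then show "f {x, y} = h \<alpha>" using xy old[of x y] split.hyps by auto
    qed
    show "h \<alpha> \<notin> colors_in f (?P A)" "h \<alpha> \<notin> colors_in f (?P B)"
    proof -
      have "h \<alpha> \<notin> N ` (X \<inter> D)" for X
        using fresh \<alpha> by (metis IntD2 image_iff)
      then show "h \<alpha> \<notin> colors_in f (?P A)" "h \<alpha> \<notin> colors_in f (?P B)"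
        using cols[of A] cols[of B] ha by (meson UnE subsetD)+
    qed
    show "?P A \<noteq> {}" "?P B \<noteq> {}" using ab sub by auto
    show "?P A \<inter> ?P B = {}" using split.hyps by auto
  qed
  moreover have "?P A \<union> ?P B = ?P (A \<union> B)" by auto
  ultimately show ?case by simp
qed

section \<open>The colouring of pairs of bit strings at one scale\<close>

text \<open>The block of length \<open>r\<close> containing \<open>i\<close> starts at
  \<open>r * (i div r)\<close>; its bits strictly before \<open>i\<close> are shifted down and read
  as one number.\<close>

definition lab :: "nat \<Rightarrow> nat \<Rightarrow> nat \<Rightarrow> nat" where
  "lab r i x = drop_bit (r * (i div r)) (take_bit i x)"

text \<open>The depth at which \<open>x\<close> and \<open>y\<close> branch in the prefix tree;
  meaningful only for distinct arguments.\<close>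

definition fdiff :: "nat \<Rightarrow> nat \<Rightarrow> nat" where
  "fdiff x y = (LEAST i. bit x i \<noteq> bit y i)"

text \<open>Equality of the \<open>b\<close>-labels says that \<open>i\<close> is the first
  difference within its \<open>b\<close>-block. The flag compares directions instead of recording
  one, so that it does not depend on the order of \<open>x\<close> and \<open>y\<close>.\<close>

definition pcol :: "nat \<Rightarrow> nat \<Rightarrow> nat \<Rightarrow> nat \<Rightarrow> (nat \<times> nat \<times> bool) set" where
  "pcol a b x y = {(i, lab a i x, bit x i = bit x (fdiff x y)) | i.
     bit x i \<noteq> bit y i \<and> lab b i x = lab b i y}"

text \<open>\<open>Min\<close> and \<open>Max\<close> merely name the two endpoints; for
  \<open>a dvd b\<close> their order is immaterial.\<close>

definition ecol :: "nat \<Rightarrow> nat \<Rightarrow> nat set \<Rightarrow> (nat \<times> nat \<times> bool) set" where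
  "ecol a b e = pcol a b (Min e) (Max e)"

text \<open>The \<open>a\<close>-block of \<open>i\<close> starts no earlier than its
  \<open>b\<close>-block, so the \<open>a\<close>-label consists of the upper bits of the
  \<open>b\<close>-label.\<close>

lemma lab_dvd:
  assumes "a dvd b" "lab b i x = lab b i y"
  shows "lab a i x = lab a i y"
proof -
  have le: "b * (i div b) \<le> a * (i div a)"
  proof -
    obtain c where c: "b = a * c" using assms by blast
    have "c * (i div a div c) \<le> i div a" by simp
    then show ?thesis unfolding c by (simp add: div_mult2_eq mult.assoc)
  qed
  have "lab a i z = drop_bit (a * (i div a) - b * (i div b)) (lab b i z)" for z
    using le by (simp add: lab_def)
  then show ?thesis using assms by simp
qed

lemma lab_take_bit: "lab r i (take_bit i x) = lab r i x"
  by (simp add: lab_def)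

lemma lab_cong: "take_bit i x = take_bit i y \<Longrightarrow> lab r i x = lab r i y"
  by (simp add: lab_def)

lemma lab_take_bit': "i \<le> j \<Longrightarrow> lab r i (take_bit j x) = lab r i x"
  by (simp add: lab_def)

lemma lab_bit_eq:
  assumes "lab r j x = lab r j y" "i < j" "i div r = j div r"
  shows "bit x i = bit y i"
proof -
  let ?s = "r * (j div r)"
  have "?s \<le> i" unfolding assms(3)[symmetric] by simp
  then have "bit (lab r j z) (i - ?s) = bit z i" for z
    using assms(2) by (simp add: lab_def bit_simps)
  then show ?thesis using assms(1) by metis
qed

lemma lab_less: assumes "r > 0" shows "lab r i x < 2 ^ r"
proof -
  let ?s = "r * (i div r)"
  have "lab r i x = take_bit (i - ?s) (drop_bit ?s x)"
    by (simp add: lab_def drop_bit_take_bit)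
  also have "\<dots> < 2 ^ (i - ?s)" by simp
  also have "i - ?s = i mod r" by (simp add: minus_mult_div_eq_mod)
  also have "(2::nat) ^ (i mod r) < 2 ^ r" using assms by simp
  finally show ?thesis .
qed

lemma fdiff_bit: "x \<noteq> y \<Longrightarrow> bit x (fdiff x y) \<noteq> bit y (fdiff x y)"
  unfolding fdiff_def by (rule LeastI_ex) (use bit_eqI in blast)

lemma fdiff_below: "i < fdiff x y \<Longrightarrow> bit x i = bit y i"
  unfolding fdiff_def using not_less_Least by blast

lemma fdiff_eqI:
  assumes "bit x i \<noteq> bit y i" "take_bit i x = take_bit i y"
  shows "fdiff x y = i"
  unfolding fdiff_def
proof (rule Least_equality)
  fix k assume "bit x k \<noteq> bit y k"
  then show "i \<le> k" using assms(2) by (metis bit_take_bit_iff not_le)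
qed (fact assms)

lemma take_bit_fdiff: "take_bit (fdiff x y) x = take_bit (fdiff x y) y"
  by (rule bit_eqI) (auto simp: bit_take_bit_iff fdiff_below)

lemma fdiff_commute: "fdiff x y = fdiff y x"
  unfolding fdiff_def by metis

lemma fdiff_take_bit:
  assumes "take_bit j x \<noteq> take_bit j y"
  shows "fdiff (take_bit j x) (take_bit j y) = fdiff x y" "fdiff x y < j"
proof -
  show lt: "fdiff x y < j"
  proof (rule ccontr)
    assume "\<not> fdiff x y < j"
    then have "take_bit j x = take_bit j (take_bit (fdiff x y) x)"
       "take_bit j y = take_bit j (take_bit (fdiff x y) y)" by (simp_all add: min_def)
    then show False using assms take_bit_fdiff by metis
  qed
  have "x \<noteq> y" using assms by auto
  show "fdiff (take_bit j x) (take_bit j y) = fdiff x y"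
  proof (rule fdiff_eqI)
    show "bit (take_bit j x) (fdiff x y) \<noteq> bit (take_bit j y) (fdiff x y)"
      using lt fdiff_bit[OF \<open>x \<noteq> y\<close>] by (simp add: bit_take_bit_iff)
    show "take_bit (fdiff x y) (take_bit j x) = take_bit (fdiff x y) (take_bit j y)"
      using lt take_bit_fdiff[of x y] by simp
  qed
qed

text \<open>Swapping \<open>x\<close> and \<open>y\<close> negates both bits compared by the flag,
  and the \<open>a\<close>-labels agree because the \<open>b\<close>-labels do.\<close>

lemma pcol_commute:
  assumes "a dvd b" "x \<noteq> y" shows "pcol a b x y = pcol a b y x"
proof -
  have "pcol a b x y \<subseteq> pcol a b y x" if "x \<noteq> y" for x y
  proof
    fix t assume "t \<in> pcol a b x y"
    then obtain i where i: "t = (i, lab a i x, bit x i = bit x (fdiff x y))"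
      "bit x i \<noteq> bit y i" "lab b i x = lab b i y" unfolding pcol_def by blast
    have "(bit x i = bit x (fdiff x y)) = (bit y i = bit y (fdiff y x))"
      using i(2) fdiff_bit[OF that] by (auto simp: fdiff_commute[of y x])
    moreover have "lab a i x = lab a i y" using lab_dvd[OF assms(1) i(3)] .
    ultimately show "t \<in> pcol a b y x" using i unfolding pcol_def by auto
  qed
  then show ?thesis using assms(2) by (metis subset_antisym)
qed

lemma ecol_pair:
  assumes "a dvd b" "x \<noteq> y" shows "ecol a b {x, y} = pcol a b x y"
  using pcol_commute[OF assms] by (auto simp: ecol_def min_def max_def)

text \<open>The first difference overall is also the first in its block. In particular the colour of
  a pair of distinct strings is never empty.\<close>

lemma fdiff_in_pcol: "x \<noteq> y \<Longrightarrow> (fdiff x y, lab a (fdiff x y) x, True) \<in> pcol a b x y"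
  unfolding pcol_def using fdiff_bit[of x y] lab_cong[OF take_bit_fdiff] by blast

lemma bit_less_exp:
  fixes x :: nat
  assumes "bit x i" "x < 2 ^ j" shows "i < j"
  using assms by (metis bit_take_bit_iff take_bit_nat_eq_self)

lemma pcol_index:
  assumes "t \<in> pcol a b x y" "x < 2 ^ j" "y < 2 ^ j" shows "fst t < j"
  using assms bit_less_exp unfolding pcol_def by fastforce

lemma pcol_same_prefix:
  assumes "x < 2 ^ Suc j" "y < 2 ^ Suc j" "x \<noteq> y" "take_bit j x = take_bit j y"
  shows "pcol a b x y = {(j, lab a j x, True)}"
proof -
  have le: "\<not> i < j" if "bit x i \<noteq> bit y i" for i
    using that assms(4) by (metis bit_take_bit_iff)
  have lt: "i < Suc j" if "bit x i \<noteq> bit y i" for i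
    using that assms(1,2) bit_less_exp by metis
  have "fdiff x y = j"
    using le[OF fdiff_bit[OF assms(3)]] lt[OF fdiff_bit[OF assms(3)]] by simp
  moreover have "i = j" if "bit x i \<noteq> bit y i" for i
    using le[OF that] lt[OF that] by simp
  ultimately have "pcol a b x y \<subseteq> {(j, lab a j x, True)}"
    unfolding pcol_def by auto
  then show ?thesis using fdiff_in_pcol[OF assms(3), of a b] \<open>fdiff x y = j\<close> by auto
qed

text \<open>The strings already branch below \<open>j\<close>, so the older triples keep their flags
  and position \<open>j\<close> contributes at most one new triple.\<close>

lemma pcol_extend:
  assumes "x < 2 ^ Suc j" "y < 2 ^ Suc j" "take_bit j x \<noteq> take_bit j y"
  shows "pcol a b x y = pcol a b (take_bit j x) (take_bit j y) \<union>
    (if bit x j \<noteq> bit y j \<and> lab b j x = lab b j y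
     then {(j, lab a j x, bit x j = bit x (fdiff x y))} else {})" (is "_ = ?P \<union> ?Q")
proof -
  note fd = fdiff_take_bit[OF assms(3)]
  have lt: "i < Suc j" if "bit x i \<noteq> bit y i" for i
    using that assms(1,2) bit_less_exp by metis
  have P: "?P = {(i, lab a i x, bit x i = bit x (fdiff x y)) | i.
     i < j \<and> bit x i \<noteq> bit y i \<and> lab b i x = lab b i y}"
    unfolding pcol_def fd(1)
    using fd(2) by (auto simp: bit_take_bit_iff lab_take_bit')
  have "i < j \<or> i = j" if "bit x i \<noteq> bit y i" for i using lt[OF that] by auto
  then show ?thesis unfolding P unfolding pcol_def by auto
qed


section \<open>Separated scales and doubled prefixes\<close>

text \<open>The strings \<open>x'\<close> and \<open>y'\<close> only witness that the prefix tree
  branches at position \<open>i\<close> on the paths of \<open>x\<close> and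
  \<open>y\<close>.\<close>

definition separated :: "nat \<Rightarrow> nat \<Rightarrow> nat set \<Rightarrow> bool" where
  "separated a b S \<longleftrightarrow> (\<forall>i. \<forall>x\<in>S. \<forall>x'\<in>S. \<forall>y\<in>S. \<forall>y'\<in>S.
     take_bit i x = take_bit i x' \<and> bit x i \<noteq> bit x' i \<and>
     take_bit i y = take_bit i y' \<and> bit y i \<noteq> bit y' i \<and> lab a i x = lab a i y
     \<longrightarrow> lab b i x = lab b i y)"

lemma separated_subset: "separated a b S \<Longrightarrow> T \<subseteq> S \<Longrightarrow> separated a b T"
  unfolding separated_def by blast

lemma separated_take_bit:
  assumes "separated a b S" shows "separated a b (take_bit j ` S)"
  unfolding separated_def
proof (intro allI ballI impI, elim conjE)
  fix i x x' y y'
  assume mem: "x \<in> take_bit j ` S" "x' \<in> take_bit j ` S" "y \<in> take_bit j ` S" "y' \<in> take_bit j ` S"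
    and h: "take_bit i x = take_bit i x'" "bit x i \<noteq> bit x' i" "take_bit i y = take_bit i y'"
      "bit y i \<noteq> bit y' i" "lab a i x = lab a i y"
  obtain u u' v v' where uv: "u \<in> S" "u' \<in> S" "v \<in> S" "v' \<in> S" "x = take_bit j u"
    "x' = take_bit j u'" "y = take_bit j v" "y' = take_bit j v'" using mem by auto
  \<comment> \<open>Truncated strings have only zeros from \<open>j\<close> on, so they can branch
    only below \<open>j\<close>, where the original strings branch too.\<close>
  have "i < j" using h(2) unfolding uv by (auto simp: bit_take_bit_iff)
  then have "take_bit i u = take_bit i u'" "bit u i \<noteq> bit u' i" "take_bit i v = take_bit i v'"
      "bit v i \<noteq> bit v' i" "lab a i u = lab a i v"
    using h unfolding uv by (auto simp: bit_take_bit_iff lab_take_bit' min_def)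
  then have "lab b i u = lab b i v"
    using assms uv(1-4) unfolding separated_def by blast
  then show "lab b i x = lab b i y" using \<open>i < j\<close> unfolding uv by (simp add: lab_take_bit')
qed

lemma bit_length_Suc_cases:
  fixes x :: nat
  assumes "x < 2 ^ Suc j"
  obtains "x < 2 ^ j" "take_bit j x = x" "\<not> bit x j"
  | z where "z < 2 ^ j" "x = z + 2 ^ j" "take_bit j x = z" "bit x j"
proof (cases "x < 2 ^ j")
  case True
  then show ?thesis using that(1) bit_less_exp by (metis less_irrefl take_bit_nat_eq_self)
next
  case False
  define z where "z = x - 2 ^ j"
  have z: "z < 2 ^ j" "x = z + 2 ^ j" using False assms by (auto simp: z_def)
  have "x mod 2 ^ j = z" "x div 2 ^ j = 1" using z by auto
  then show ?thesis using that(2)[OF z] by (simp add: take_bit_eq_mod bit_iff_odd)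
qed

lemma add_exp_bits:
  fixes z :: nat
  assumes "z < 2 ^ j"
  shows "take_bit j (z + 2 ^ j) = z" "bit (z + 2 ^ j) j"
    "\<And>i. i < j \<Longrightarrow> bit (z + 2 ^ j) i = bit z i"
proof -
  have "(z + 2 ^ j) mod 2 ^ j = z" "(z + 2 ^ j) div 2 ^ j = 1" using assms by auto
  then show *: "take_bit j (z + 2 ^ j) = z" "bit (z + 2 ^ j) j"
    by (simp_all add: take_bit_eq_mod bit_iff_odd)
  show "bit (z + 2 ^ j) i = bit z i" if "i < j" for i
    using *(1) that by (metis bit_take_bit_iff)
qed

text \<open>The prefixes with both extensions in \<open>W\<close>. As a number, a prefix equals its
  extension by 0, so these prefixes are themselves elements of \<open>W\<close>.\<close>

definition doubled :: "nat \<Rightarrow> nat set \<Rightarrow> nat set" where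
  "doubled j W = {d \<in> W. d < 2 ^ j \<and> d + 2 ^ j \<in> W}"

text \<open>Inclusion-exclusion for the prefixes that extend by 0 and those that extend by 1: the
  union is the set of all prefixes, the intersection the doubled ones.\<close>

lemma card_doubled:
  assumes "finite W" "W \<subseteq> {..<2 ^ Suc j}"
  shows "card W = card (take_bit j ` W) + card (doubled j W)"
proof -
  let ?Lo = "{z \<in> W. z < 2 ^ j}" and ?Up = "{z. z < 2 ^ j \<and> z + 2 ^ j \<in> W}"
  have fin: "finite ?Lo" "finite ?Up" using assms(1) by auto
  have "W = ?Lo \<union> (\<lambda>z. z + 2 ^ j) ` ?Up"
  proof (intro subset_antisym subsetI)
    fix x assume "x \<in> W"
    then have "x < 2 ^ Suc j" using assms by auto
    then show "x \<in> ?Lo \<union> (\<lambda>z. z + 2 ^ j) ` ?Up"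
      by (cases rule: bit_length_Suc_cases) (use \<open>x \<in> W\<close> in auto)
  qed auto
  moreover have "?Lo \<inter> (\<lambda>z. z + 2 ^ j) ` ?Up = {}" by auto
  ultimately have "card W = card ?Lo + card ((\<lambda>z. z + 2 ^ j) ` ?Up)"
    using fin card_Un_disjoint by (metis (no_types, lifting) finite_imageI)
  also have "card ((\<lambda>z. z + 2 ^ j) ` ?Up) = card ?Up" by (rule card_image) simp
  finally have W: "card W = card ?Lo + card ?Up" .
  have "take_bit j ` W = ?Lo \<union> ?Up"
  proof (intro subset_antisym subsetI)
    fix v assume "v \<in> take_bit j ` W"
    then obtain x where x: "x \<in> W" "v = take_bit j x" by auto
    then have "x < 2 ^ Suc j" using assms by auto
    then show "v \<in> ?Lo \<union> ?Up"
      by (cases rule: bit_length_Suc_cases) (use x in auto)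
  next
    fix v assume "v \<in> ?Lo \<union> ?Up"
    then show "v \<in> take_bit j ` W"
      by (metis (no_types, lifting) UnE add_exp_bits(1) imageI mem_Collect_eq take_bit_nat_eq_self)
  qed
  moreover have "doubled j W = ?Lo \<inter> ?Up" by (auto simp: doubled_def)
  ultimately show ?thesis using W card_Un_Int[OF fin] by simp
qed

text \<open>The two crosswise pairs branch where \<open>d\<close> and \<open>e\<close> do but differ
  at \<open>j\<close> in opposite directions, so their flags at \<open>j\<close> are opposite and
  one of them equals \<open>s\<close>. Equal \<open>b\<close>-labels ensure that position
  \<open>j\<close> is recorded.\<close>

lemma ecol_signs:
  assumes "a dvd b" "d < 2 ^ j" "e < 2 ^ j" "d \<noteq> e" "lab b j d = lab b j e"
  shows "insert (j, lab a j d, s) (ecol a b {d, e}) \<in>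
    {ecol a b {d, e + 2 ^ j}, ecol a b {d + 2 ^ j, e}}"
proof -
  note d = add_exp_bits[OF assms(2)] and e = add_exp_bits[OF assms(3)]
  have td: "take_bit j d = d" "take_bit j e = e" using assms by (simp_all add: take_bit_nat_eq_self)
  have nb: "\<not> bit d j" "\<not> bit e j" using assms(2,3) bit_less_exp by blast+
  have ld: "lab r j (z + 2 ^ j) = lab r j z" if "z < 2 ^ j" for r z
    using lab_take_bit[of r j "z + 2 ^ j"] add_exp_bits(1)[OF that] by simp
  have fd: "fdiff d (e + 2 ^ j) = fdiff d e" "fdiff (d + 2 ^ j) e = fdiff d e" "fdiff d e < j"
    using fdiff_take_bit[of j d "e + 2 ^ j"] fdiff_take_bit[of j "d + 2 ^ j" e] d e td assms(4) by simp_all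
  have "pcol a b d (e + 2 ^ j) = insert (j, lab a j d, bit d j = bit d (fdiff d e)) (pcol a b d e)"
    using pcol_extend[of d j "e + 2 ^ j" a b] assms d e td nb fd ld by auto
  moreover have "pcol a b (d + 2 ^ j) e = insert (j, lab a j d, bit (d + 2 ^ j) j = bit d (fdiff d e)) (pcol a b d e)"
    using pcol_extend[of "d + 2 ^ j" j e a b] assms d e td nb fd ld by auto
  moreover have "d \<noteq> e + 2 ^ j" "d + 2 ^ j \<noteq> e" using assms by auto
  ultimately show ?thesis
    using ecol_pair[OF assms(1) assms(4)] ecol_pair[OF assms(1), of d "e + 2 ^ j"]
      ecol_pair[OF assms(1), of "d + 2 ^ j" e] d(2) nb
    by (cases s; cases "bit d (fdiff d e)") simp_all
qed

lemma ecol_extend: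
  assumes "a dvd b" "x < 2 ^ Suc j" "y < 2 ^ Suc j" "take_bit j x \<noteq> take_bit j y"
  shows "{t \<in> ecol a b {x, y}. fst t < j} = ecol a b {take_bit j x, take_bit j y}"
proof -
  have "x \<noteq> y" using assms(4) by auto
  have "fst t < j" if "t \<in> pcol a b (take_bit j x) (take_bit j y)" for t
    using pcol_index[OF that] by simp
  then show ?thesis
    using pcol_extend[OF assms(2-4), of a b] ecol_pair[OF assms(1) assms(4)]
      ecol_pair[OF assms(1) \<open>x \<noteq> y\<close>]
    by (auto split: if_splits)
qed

lemma ecol_same_prefix:
  assumes "a dvd b" "x < 2 ^ Suc j" "y < 2 ^ Suc j" "take_bit j x = take_bit j y" "x \<noteq> y"
  shows "ecol a b {x, y} = {(j, lab a j (take_bit j x), True)}"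
  using pcol_same_prefix[OF assms(2,3,5,4)] ecol_pair[OF assms(1,5)] by (simp add: lab_take_bit)


section \<open>Counting colours when the strings grow by one bit\<close>

text \<open>Three families of colours of \<open>W\<close> are pairwise disjoint: \<open>N\<close>
  for the doubled pairs, a lift \<open>h\<close> of every colour of the prefixes, and
  \<open>E\<close>, the colours inside a class enlarged by a triple at \<open>j\<close>. Truncation
  to positions below \<open>j\<close> tells them apart. If the first two families exhaust the
  colours, \<open>W\<close> is a blow-up of \<open>V\<close>.\<close>

lemma colors_step:
  fixes a b j :: nat and W :: "nat set"
  defines "f \<equiv> ecol a b"
  defines "Dl \<equiv> \<lambda>l. {d \<in> doubled j W. lab a j d = l}"
    and "L \<equiv> lab a j ` doubled j W" and "V \<equiv> take_bit j ` W"
  assumes dvd: "a dvd b" and fin: "finite W" and W: "W \<subseteq> {..<2 ^ Suc j}"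
    and sep: "separated a b W"
  shows "card L + card (colors_in f V) + 2 * (\<Sum>l\<in>L. card (colors_in f (Dl l))) \<le> card (colors_in f W)"
    and "\<lbrakk>card (colors_in f W) = card L + card (colors_in f V); inj_on (lab a j) (doubled j W);
      leftover f V\<rbrakk> \<Longrightarrow> leftover f W"
proof -
  define tr :: "(nat \<times> nat \<times> bool) set \<Rightarrow> _" where "tr e = {t \<in> e. fst t < j}" for e
  define G where "G = colors_in f V"
  \<comment> \<open>A lift of \<open>c\<close> along truncation. It is \<open>c\<close> itself
    whenever \<open>c\<close> occurs in \<open>W\<close>, which keeps the lifts away from
    \<open>E\<close>.\<close>
  define h where "h c = (if c \<in> colors_in f W then c else SOME e. e \<in> colors_in f W \<and> tr e = c)" for c
  define N where "N l = {(j, l, True)}" for l :: nat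
  define E where "E = (\<lambda>(l, c, s). insert (j, l, s) c) ` Sigma L (\<lambda>l. colors_in f (Dl l) \<times> (UNIV :: bool set))"
  have lt: "x < 2 ^ Suc j" if "x \<in> W" for x using that W by auto
  have top: "x = take_bit j x \<or> x = take_bit j x + 2 ^ j" if "x \<in> W" for x
    using lt[OF that] by (cases rule: bit_length_Suc_cases) auto
  have tr_ext: "tr (f {x, y}) = f {take_bit j x, take_bit j y}"
    if "x \<in> W" "y \<in> W" "take_bit j x \<noteq> take_bit j y" for x y
    using ecol_extend[OF dvd lt lt] that unfolding tr_def f_def by blast
  have same: "f {x, y} = N (lab a j (take_bit j x))"
    if "x \<in> W" "y \<in> W" "take_bit j x = take_bit j y" "x \<noteq> y" for x y
    using ecol_same_prefix[OF dvd lt lt] that unfolding N_def f_def by blast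
  have trN: "tr (N l) = {}" for l by (simp add: tr_def N_def)
  \<comment> \<open>Nonemptiness separates the lifts from the colours \<open>N l\<close>, whose
    truncation is empty.\<close>
  have G_ne: "c \<noteq> {} \<and> tr c = c" if c: "c \<in> G" for c
  proof -
    obtain u v where uv: "u \<in> V" "v \<in> V" "u \<noteq> v" "c = f {u, v}"
      using c unfolding G_def by (rule colors_inE)
    have "u < 2 ^ j" "v < 2 ^ j" using uv by (auto simp: V_def)
    then have "\<forall>t\<in>c. fst t < j"
      using pcol_index uv ecol_pair[OF dvd uv(3)] unfolding f_def by blast
    moreover have "c \<noteq> {}"
      using fdiff_in_pcol[OF uv(3)] uv ecol_pair[OF dvd uv(3)] unfolding f_def by blast
    ultimately show ?thesis by (auto simp: tr_def)
  qed
  have ex: "\<exists>e. e \<in> colors_in f W \<and> tr e = c" if c: "c \<in> G" for c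
  proof -
    obtain u v where uv: "u \<in> V" "v \<in> V" "u \<noteq> v" "c = f {u, v}"
      using c unfolding G_def by (rule colors_inE)
    then obtain x y where "x \<in> W" "y \<in> W" "u = take_bit j x" "v = take_bit j y"
      unfolding V_def by blast
    then show ?thesis using uv tr_ext[of x y] colors_inI[of x W y f] by blast
  qed
  have h: "h c \<in> colors_in f W" "tr (h c) = c" if c: "c \<in> G" for c
    using someI_ex[OF ex[OF c]] G_ne[OF c] unfolding h_def by auto
  have injh: "inj_on h G" using h(2) by (metis inj_onI)
  have DlW: "Dl l \<subseteq> W" "Dl l \<subseteq> V" for l
  proof -
    show "Dl l \<subseteq> W" unfolding Dl_def doubled_def by blast
    show "Dl l \<subseteq> V"
    proof
      fix d assume "d \<in> Dl l"
      then have "d \<in> W" "take_bit j d = d"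
        by (auto simp: Dl_def doubled_def take_bit_nat_eq_self)
      then show "d \<in> V" unfolding V_def by (metis imageI)
    qed
  qed
  have dbl: "take_bit j d = d" "take_bit j (d + 2 ^ j) = d" "d < 2 ^ j" "d \<in> W" "d + 2 ^ j \<in> W"
    "\<not> bit d j" "bit (d + 2 ^ j) j"
    if "d \<in> doubled j W" for d
    using that add_exp_bits[of d j] bit_less_exp[of d j j]
    by (auto simp: doubled_def take_bit_nat_eq_self)
  have cG: "c \<in> G" "c \<in> colors_in f W" if "c \<in> colors_in f (Dl l)" for c l
    using that colors_in_mono[OF DlW(1), of f l] colors_in_mono[OF DlW(2), of f l]
    unfolding G_def by blast+
  have signs: "insert (j, l, s) c \<in> colors_in f W" if c: "c \<in> colors_in f (Dl l)" for l c s
  proof -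
    obtain d e where de: "d \<in> Dl l" "e \<in> Dl l" "d \<noteq> e" "c = f {d, e}"
      using c by (rule colors_inE)
    then have D: "d \<in> doubled j W" "e \<in> doubled j W" "lab a j d = l" "lab a j e = l"
      by (auto simp: Dl_def)
    note d = dbl[OF D(1)] and e = dbl[OF D(2)]
    \<comment> \<open>Both \<open>d\<close> and \<open>e\<close> branch at \<open>j\<close>, with
      their extensions by 1 as witnesses, so separation turns the common \<open>a\<close>-label into
      a common \<open>b\<close>-label.\<close>
    have "take_bit j d = take_bit j (d + 2 ^ j) \<and> bit d j \<noteq> bit (d + 2 ^ j) j \<and>
      take_bit j e = take_bit j (e + 2 ^ j) \<and> bit e j \<noteq> bit (e + 2 ^ j) j \<and> lab a j d = lab a j e"
      using d e D by simp
    then have "lab b j d = lab b j e"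
      using sep d(4,5) e(4,5) unfolding separated_def by blast
    then have "insert (j, l, s) c \<in> {f {d, e + 2 ^ j}, f {d + 2 ^ j, e}}"
      using ecol_signs[OF dvd d(3) e(3) de(3)] D(3) de(4) unfolding f_def by blast
    moreover have "d \<noteq> e + 2 ^ j" "d + 2 ^ j \<noteq> e" using d(3) e(3) by auto
    ultimately show ?thesis
      using colors_inI[of d W "e + 2 ^ j" f] colors_inI[of "d + 2 ^ j" W e f] d(4,5) e(4,5) by auto
  qed
  have finV: "finite V" using fin by (simp add: V_def)
  have finD: "finite (doubled j W)" using fin by (simp add: doubled_def)
  have finL: "finite L" using finD by (simp add: L_def)
  have finDl: "finite (Dl l)" for l using finD by (simp add: Dl_def)
  have NL: "N ` L \<subseteq> colors_in f W"
  proof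
    fix c assume "c \<in> N ` L"
    then obtain d where d: "d \<in> doubled j W" "c = N (lab a j d)" by (auto simp: L_def)
    note dd = dbl[OF d(1)]
    then show "c \<in> colors_in f W"
      using same[of d "d + 2 ^ j"] colors_inI[of d W "d + 2 ^ j" f] d by simp
  qed
  have E_sub: "E \<subseteq> colors_in f W" unfolding E_def using signs by auto
  have nj: "(j, l, s) \<notin> c" if "c \<in> G" for l s c
  proof
    assume "(j, l, s) \<in> c"
    then have "(j, l, s) \<in> tr c" using G_ne[OF that] by simp
    then show False by (simp add: tr_def)
  qed
  have tr_ins: "tr (insert (j, l, s) c) = c" if "c \<in> G" for l s c
  proof -
    have "tr (insert (j, l, s) c) = tr c" by (auto simp: tr_def)
    then show ?thesis using G_ne[OF that] by simp
  qed
  \<comment> \<open>Truncation recovers \<open>c\<close>, and the single triple at \<open>j\<close>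
    recovers \<open>l\<close> and \<open>s\<close>.\<close>
  have injE: "inj_on (\<lambda>(l, c, s). insert (j, l, s) c)
     (Sigma L (\<lambda>l. colors_in f (Dl l) \<times> (UNIV :: bool set)))"
  proof (rule inj_onI, clarsimp)
    fix l c s l' c' s'
    assume c: "c \<in> colors_in f (Dl l)" "c' \<in> colors_in f (Dl l')"
      and eq: "insert (j, l, s) c = insert (j, l', s') c'"
    have "c = c'" using tr_ins[OF cG(1)[OF c(1)], of l s] tr_ins[OF cG(1)[OF c(2)], of l' s'] eq by simp
    moreover have "(j, l, s) = (j, l', s')"
      using eq nj[OF cG(1)[OF c(1)]] nj[OF cG(1)[OF c(2)]] by blast
    ultimately show "l = l' \<and> c = c' \<and> s = s'" by simp
  qed
  have cardE: "card E = 2 * (\<Sum>l\<in>L. card (colors_in f (Dl l)))"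
    unfolding E_def card_image[OF injE]
    using finL finDl by (subst card_SigmaI) (auto simp: card_cartesian_product sum_distrib_left mult.commute)
  have cardN: "card (N ` L) = card L" by (rule card_image) (auto simp: inj_on_def N_def)
  have cardG: "card (h ` G) = card (colors_in f V)" using card_image[OF injh] by (simp add: G_def)
  have finE: "finite E" by (rule finite_subset[OF E_sub finite_colors_in[OF fin]])
  have finG: "finite (h ` G)" using finV by (simp add: G_def)
  have dNG: "N ` L \<inter> h ` G = {}"
  proof (rule equals0I)
    fix e assume "e \<in> N ` L \<inter> h ` G"
    then obtain c l where "c \<in> G" "e = h c" "e = N l" by blast
    then show False using h(2)[of c] trN[of l] G_ne[of c] by simp
  qed
  \<comment> \<open>A member of \<open>E\<close> truncates to some \<open>c\<close> that occurs in
    \<open>W\<close> as it stands. The only lift with that truncation is then \<open>c\<close>,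
    which has no triple at \<open>j\<close>.\<close>
  have dE: "E \<inter> (N ` L \<union> h ` G) = {}"
  proof (rule equals0I)
    fix e assume e: "e \<in> E \<inter> (N ` L \<union> h ` G)"
    then obtain l c s where c: "c \<in> colors_in f (Dl l)" "e = insert (j, l, s) c"
      unfolding E_def by auto
    have "tr e = c" using c tr_ins cG by blast
    then have "e \<notin> N ` L" using trN G_ne[OF cG(1)[OF c(1)]] by blast
    then obtain c' where c': "c' \<in> G" "e = h c'" using e by blast
    then have "c' = c" using \<open>tr e = c\<close> h by blast
    then have "e = c" using c' cG(2)[OF c(1)] by (simp add: h_def)
    then show False using nj[OF cG(1)[OF c(1)]] c(2) by blast
  qed
  have card_un: "card (N ` L \<union> h ` G) = card L + card (colors_in f V)"
    using card_Un_disjoint[OF _ finG dNG] finL cardN cardG by simp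
  have sub: "N ` L \<union> h ` G \<subseteq> colors_in f W" using NL h(1) by blast
  have "card (E \<union> (N ` L \<union> h ` G)) = card E + card (N ` L \<union> h ` G)"
    using card_Un_disjoint[OF finE _ dE] finL finG by simp
  moreover have "card (E \<union> (N ` L \<union> h ` G)) \<le> card (colors_in f W)"
    by (rule card_mono[OF finite_colors_in[OF fin] Un_least[OF E_sub sub]])
  ultimately show "card L + card (colors_in f V) + 2 * (\<Sum>l\<in>L. card (colors_in f (Dl l)))
      \<le> card (colors_in f W)" using card_un cardE by simp
  \<comment> \<open>Together with the bound just shown, this equality means that the classes
    contribute no colours and that nothing lies outside the first two families.\<close>
  assume eq: "card (colors_in f W) = card L + card (colors_in f V)"
    and inj: "inj_on (lab a j) (doubled j W)" and lV: "leftover f V"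
  have all: "colors_in f W = N ` L \<union> h ` G"
    using card_subset_eq[OF finite_colors_in[OF fin] sub] card_un eq by simp
  have "leftover f {x \<in> W. take_bit j x \<in> V}"
  proof (rule leftover_blowup[OF lV, where h = h and D = "doubled j W" and N = "\<lambda>d. N (lab a j d)"])
    fix x y assume xy: "x \<in> W" "y \<in> W" "take_bit j x \<noteq> take_bit j y"
    have g: "f {take_bit j x, take_bit j y} \<in> G"
      unfolding G_def V_def using xy by (intro colors_inI) auto
    have "f {x, y} \<in> colors_in f W" using xy by (intro colors_inI) auto
    \<comment> \<open>The truncation of \<open>f {x, y}\<close> is a colour of \<open>V\<close>,
      hence nonempty, which rules out the family \<open>N\<close>.\<close>
    then obtain c where c: "c \<in> G" "f {x, y} = h c"
      using all trN tr_ext[OF xy] G_ne[OF g] by (metis (no_types, lifting) UnE imageE)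
    then show "f {x, y} = h (f {take_bit j x, take_bit j y})"
      using tr_ext[OF xy] h(2) by metis
  next
    show "inj_on h (colors_in f (take_bit j ` W))" using injh by (simp add: G_def V_def)
    show "inj_on (\<lambda>d. N (lab a j d)) (doubled j W)"
      using inj by (auto simp: inj_on_def N_def)
    fix d assume "d \<in> doubled j W"
    then show "N (lab a j d) \<notin> h ` colors_in f (take_bit j ` W)"
      using dNG by (auto simp: L_def G_def V_def)
  next
    fix x y assume xy: "x \<in> W" "y \<in> W" "take_bit j x = take_bit j y" "x \<noteq> y"
    show "f {x, y} = N (lab a j (take_bit j x))" using same xy by blast
    \<comment> \<open>Distinct strings with a common prefix are its extension by 0, equal to the
      prefix, and its extension by 1.\<close>
    have "take_bit j x \<in> W \<and> take_bit j x + 2 ^ j \<in> W"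
      using top[OF xy(1)] top[OF xy(2)] xy by metis
    then show "take_bit j x \<in> doubled j W" by (simp add: doubled_def)
  next
    fix x y z assume xyz: "x \<in> W" "y \<in> W" "z \<in> W" "take_bit j x = take_bit j y"
      "take_bit j y = take_bit j z"
    then show "x = y \<or> y = z \<or> x = z"
      using top[OF xyz(1)] top[OF xyz(2)] top[OF xyz(3)] by metis
  qed (simp add: V_def)
  moreover have "{x \<in> W. take_bit j x \<in> V} = W" by (auto simp: V_def)
  ultimately show "leftover f W" by simp
qed

text \<open>Induction on the string length, with the hypothesis applied both to the prefixes and to
  each label class of doubled elements, which again consists of strings of length
  \<open>j\<close>.\<close>

lemma separated_colors:
  assumes "a dvd b" "finite S" "S \<noteq> {}" "S \<subseteq> {..<2 ^ j}" "separated a b S"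
  shows "card S \<le> card (colors_in (ecol a b) S) + 1 \<and>
    (card S = card (colors_in (ecol a b) S) + 1 \<longrightarrow> leftover (ecol a b) S)"
  using assms(2-)
proof (induction j arbitrary: S)
  case 0
  then have "S = {0}" by auto
  then show ?case by (simp add: leftover.single)
next
  case (Suc j)
  let ?f = "ecol a b" and ?V = "take_bit j ` S" and ?D = "doubled j S"
  let ?L = "lab a j ` ?D"
  let ?Dl = "\<lambda>l. {d \<in> ?D. lab a j d = l}"
  have finD: "finite ?D" using Suc.prems(1) by (simp add: doubled_def)
  note step = colors_step[OF assms(1) Suc.prems(1,3,4)]
  have V: "card ?V \<le> card (colors_in ?f ?V) + 1 \<and>
    (card ?V = card (colors_in ?f ?V) + 1 \<longrightarrow> leftover ?f ?V)"
    using Suc.prems separated_take_bit by (intro Suc.IH) auto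
  have Dl: "card (?Dl l) \<le> card (colors_in ?f (?Dl l)) + 1" if "l \<in> ?L" for l
  proof -
    have "separated a b (?Dl l)"
      by (rule separated_subset[OF Suc.prems(4)]) (auto simp: doubled_def)
    then have "card (?Dl l) \<le> card (colors_in ?f (?Dl l)) + 1 \<and>
    (card (?Dl l) = card (colors_in ?f (?Dl l)) + 1 \<longrightarrow> leftover ?f (?Dl l))"
      using that finD by (intro Suc.IH) (auto simp: doubled_def)
    then show ?thesis by blast
  qed
  have "card ?D = (\<Sum>l\<in>?L. card (?Dl l))"
    unfolding card_eq_sum by (rule sum.image_gen[OF finD])
  also have "\<dots> \<le> (\<Sum>l\<in>?L. card (colors_in ?f (?Dl l)) + 1)"
    by (rule sum_mono) (rule Dl)
  also have "\<dots> = (\<Sum>l\<in>?L. card (colors_in ?f (?Dl l))) + card ?L"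
    by (simp only: sum.distrib) simp
  finally have cD: "card ?D \<le> (\<Sum>l\<in>?L. card (colors_in ?f (?Dl l))) + card ?L" .
  have cS: "card S = card ?V + card ?D" by (rule card_doubled) (use Suc.prems in auto)
  have Lle: "card ?L \<le> card ?D" by (rule card_image_le[OF finD])
  show ?case
  proof (intro conjI impI)
    show "card S \<le> card (colors_in ?f S) + 1" using step(1) V cD cS by linarith
    assume eq: "card S = card (colors_in ?f S) + 1"
    \<comment> \<open>The lower bound counts the colours inside the classes twice while the bound on
      \<open>card ?D\<close> spends them once; equality forces their number to be 0 and every other
      estimate to be tight.\<close>
    have "card ?V = card (colors_in ?f ?V) + 1" "card ?L = card ?D"
      "card (colors_in ?f S) = card ?L + card (colors_in ?f ?V)"
      using eq step(1) V cD cS Lle by linarith+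
    then show "leftover ?f S"
      using step(2) V finD by (simp add: eq_card_imp_inj_on)
  qed
qed


section \<open>A separated scale for every small set\<close>

text \<open>A scale that is not separated yields a quadruple from \<open>S\<close>, and no quadruple
  arises from two scales, so at most \<open>card S ^ 4\<close> scales fail.\<close>

lemma exists_separated_scale:
  assumes "finite S" "card S ^ 4 < K"
  shows "\<exists>k<K. separated (B ^ k) (B ^ Suc k) S"
proof (rule ccontr)
  assume none: "\<not> ?thesis"
  define P where "P k i x x' y y' \<longleftrightarrow> x \<in> S \<and> x' \<in> S \<and> y \<in> S \<and> y' \<in> S \<and>
     take_bit i x = take_bit i x' \<and> bit x i \<noteq> bit x' i \<and>
     lab (B ^ k) i x = lab (B ^ k) i y \<and> lab (B ^ Suc k) i x \<noteq> lab (B ^ Suc k) i y"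
    for k i x x' y y'
  have "\<exists>q i. P k i (fst q) (fst (snd q)) (fst (snd (snd q))) (snd (snd (snd q)))" if k: "k < K" for k
  proof -
    obtain i x x' y y' where "P k i x x' y y'"
      using none k unfolding separated_def P_def by metis
    then show ?thesis by (intro exI[of _ "(x, x', y, y')"] exI[of _ i]) simp
  qed
  then obtain q where q: "\<And>k. k < K \<Longrightarrow>
     \<exists>i. P k i (fst (q k)) (fst (snd (q k))) (fst (snd (snd (q k)))) (snd (snd (snd (q k))))"
    by metis
  have "\<not> (k < k' \<and> q k = q k')" if kk: "k < K" "k' < K" for k k'
  proof
    assume a: "k < k' \<and> q k = q k'"
    obtain x x' y y' where xy: "q k = (x, x', y, y')" by (metis surj_pair)
    obtain i i' where i: "P k i x x' y y'" "P k' i' x x' y y'"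
    proof -
      have "q k' = (x, x', y, y')" using a xy by simp
      then show ?thesis using that q[OF kk(1)] q[OF kk(2)] xy by fastforce
    qed
    \<comment> \<open>The quadruple determines the position. Agreement on the block at the larger
      scale \<open>k'\<close> then implies agreement on the block of length
      \<open>B ^ Suc k\<close>, contrary to the failure at \<open>k\<close>.\<close>
    have "i = fdiff x x'" "i' = fdiff x x'"
      using i fdiff_eqI unfolding P_def by metis+
    moreover have "B ^ Suc k dvd B ^ k'" using a by (intro le_imp_power_dvd) simp
    ultimately show False using i lab_dvd unfolding P_def by blast
  qed
  then have "inj_on q {..<K}"
    by (intro inj_onI) (metis lessThan_iff nat_neq_iff)
  moreover have "q ` {..<K} \<subseteq> S \<times> S \<times> S \<times> S"
  proof
    fix z assume "z \<in> q ` {..<K}"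
    then obtain k i where "z = q k" "P k i (fst z) (fst (snd z)) (fst (snd (snd z))) (snd (snd (snd z)))"
      using q by fastforce
    then show "z \<in> S \<times> S \<times> S \<times> S" unfolding P_def by (simp add: mem_Times_iff)
  qed
  ultimately have "K \<le> card (S \<times> S \<times> S \<times> S)"
    using card_inj_on_le[of q "{..<K}" "S \<times> S \<times> S \<times> S"] assms(1) by simp
  then show False using assms(2) by (simp add: card_cartesian_product eval_nat_numeral)
qed

section \<open>The product colouring and its number of colours\<close>

text \<open>Every such set is the range of a list of length exactly \<open>q\<close>: repeat one of
  its elements as padding, which is where nonemptiness enters.\<close>

lemma card_nonempty_subsets_le:
  assumes "finite U"
  shows "finite {e. e \<noteq> {} \<and> e \<subseteq> U \<and> card e \<le> q}"
    and "card {e. e \<noteq> {} \<and> e \<subseteq> U \<and> card e \<le> q} \<le> card U ^ q"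
proof -
  let ?X = "{e. e \<noteq> {} \<and> e \<subseteq> U \<and> card e \<le> q}" and ?Y = "{xs. set xs \<subseteq> U \<and> length xs = q}"
  have "?X \<subseteq> set ` ?Y"
  proof
    fix e assume e: "e \<in> ?X"
    then have "finite e" using assms finite_subset by auto
    then obtain xs where xs: "set xs = e" "length xs = card e"
      by (metis finite_distinct_list distinct_card)
    obtain z where z: "z \<in> e" using e by auto
    have "set (xs @ replicate (q - card e) z) = e" using xs z by auto
    moreover have "length (xs @ replicate (q - card e) z) = q" using xs e by simp
    ultimately show "e \<in> set ` ?Y" using e by (metis (mono_tags, lifting) imageI mem_Collect_eq)
  qed
  note sub = this
  have fin: "finite ?Y" using finite_lists_length_eq[OF assms] by simp
  show "finite ?X" using finite_surj[OF fin sub] .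
  have "card ?X \<le> card ?Y" using surj_card_le[OF fin sub] .
  also have "\<dots> = card U ^ q" using card_lists_length_eq[OF assms] by simp
  finally show "card ?X \<le> card U ^ q" .
qed

text \<open>Only the first difference inside each of the q blocks of length b contributes a triple.\<close>

lemma card_pcol_le:
  assumes "b > 0" "x < 2 ^ (b * q)" "y < 2 ^ (b * q)"
  shows "card (pcol a b x y) \<le> q"
proof -
  let ?I = "{i. bit x i \<noteq> bit y i \<and> lab b i x = lab b i y}"
  have "i div b < q" if "i \<in> ?I" for i
  proof -
    have "i < b * q" using that assms bit_less_exp by blast
    then show ?thesis using assms(1) by (simp add: less_mult_imp_div_less mult.commute)
  qed
  then have sub: "(\<lambda>i. i div b) ` ?I \<subseteq> {..<q}" by blast
  have less: "\<not> i < i'" if "i \<in> ?I" "i' \<in> ?I" "i div b = i' div b" for i i'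
    using that lab_bit_eq[of b i' x y i] by blast
  have inj: "inj_on (\<lambda>i. i div b) ?I"
  proof (rule inj_onI)
    fix i i' assume "i \<in> ?I" "i' \<in> ?I" "i div b = i' div b"
    then show "i = i'" using less[of i i'] less[of i' i] by (metis nat_neq_iff)
  qed
  have fin: "finite ?I" using inj sub by (meson finite_imageD finite_lessThan finite_subset)
  have "card ?I \<le> q" using card_inj_on_le[OF inj sub] by simp
  moreover have "pcol a b x y = (\<lambda>i. (i, lab a i x, bit x i = bit x (fdiff x y))) ` ?I"
    unfolding pcol_def by blast
  ultimately show ?thesis using card_image_le[OF fin] by (metis (no_types, lifting) le_trans)
qed

text \<open>A colour is a nonempty set of at most \<open>q\<close> triples, with
  \<open>b * q\<close> positions, \<open>2 ^ a\<close> labels and two flags to choose from.\<close>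

lemma card_colors_ecol:
  assumes "a dvd b" "a > 0" "b > 0" "S \<subseteq> {..<2 ^ (b * q)}"
  shows "card (colors_in (ecol a b) S) \<le> (b * q * 2 ^ Suc a) ^ q"
proof -
  let ?U = "{..<b * q} \<times> {..<2 ^ a :: nat} \<times> (UNIV :: bool set)"
  have "colors_in (ecol a b) S \<subseteq> {e. e \<noteq> {} \<and> e \<subseteq> ?U \<and> card e \<le> q}"
  proof
    fix c assume "c \<in> colors_in (ecol a b) S"
    then obtain x y where xy: "x \<in> S" "y \<in> S" "x \<noteq> y" "c = ecol a b {x, y}" by (rule colors_inE)
    have c: "c = pcol a b x y" using xy ecol_pair[OF assms(1)] by simp
    have lt: "x < 2 ^ (b * q)" "y < 2 ^ (b * q)" using xy assms(4) by auto
    have "card c \<le> q" "c \<noteq> {}"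
      using card_pcol_le[OF assms(3) lt] fdiff_in_pcol[OF xy(3)] c by auto
    moreover have "c \<subseteq> ?U"
    proof
      fix t assume t: "t \<in> c"
      then have "fst t < b * q" using pcol_index lt c by blast
      moreover have "fst (snd t) < 2 ^ a"
        using t lab_less[OF assms(2)] unfolding c pcol_def by auto
      ultimately show "t \<in> ?U" by (auto simp: mem_Times_iff)
    qed
    ultimately show "c \<in> {e. e \<noteq> {} \<and> e \<subseteq> ?U \<and> card e \<le> q}" by blast
  qed
  then have "card (colors_in (ecol a b) S) \<le> card {e. e \<noteq> {} \<and> e \<subseteq> ?U \<and> card e \<le> q}"
    by (intro card_mono card_nonempty_subsets_le) simp
  also have "\<dots> \<le> card ?U ^ q" by (rule card_nonempty_subsets_le) simp
  also have "card ?U = b * q * 2 ^ Suc a" by (simp add: card_cartesian_product)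
  finally show ?thesis .
qed

text \<open>Restricting to \<open>{..<K}\<close> fixes the value elsewhere, so that colours are
  elements of a finite \<open>PiE\<close>.\<close>

definition multicol :: "nat \<Rightarrow> nat \<Rightarrow> nat set \<Rightarrow> nat \<Rightarrow> (nat \<times> nat \<times> bool) set" where
  "multicol K B e = (\<lambda>k\<in>{..<K}. ecol (B ^ k) (B ^ Suc k) e)"

text \<open>At scale \<open>k\<close> there are \<open>B ^ (K - Suc k)\<close> blocks with labels of
  at most \<open>B ^ k\<close> bits. The product of the two is \<open>B ^ (K - 1)\<close> at every
  scale, a factor \<open>B\<close> below the string length.\<close>

lemma card_colors_multicol:
  assumes "B \<ge> 2" "K > 0" "S \<subseteq> {..<2 ^ (B ^ K)}"
  shows "card (colors_in (multicol K B) S) \<le> (4 * B ^ K) ^ (K * B ^ (K - 1))"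
proof -
  let ?C = "\<lambda>k. colors_in (ecol (B ^ k) (B ^ Suc k)) S"
  have fS: "finite S" using assms(3) finite_subset by blast
  have one: "card (?C k) \<le> (4 * B ^ K) ^ (B ^ (K - 1))" if k: "k < K" for k
  proof -
    let ?q = "B ^ (K - Suc k)"
    have K: "B ^ Suc k * ?q = B ^ K" "B ^ k * ?q = B ^ (K - 1)"
      using k by (simp_all flip: power_add power_Suc)
    have pos: "B ^ k > 0" "B ^ K > 0" using assms by auto
    have "card (?C k) \<le> (B ^ K * 2 ^ Suc (B ^ k)) ^ ?q"
      using card_colors_ecol[of "B ^ k" "B ^ Suc k" S ?q] assms K by (simp add: le_imp_power_dvd)
    also have "\<dots> \<le> ((4 * B ^ K) ^ (B ^ k)) ^ ?q"
    proof (rule power_mono)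
      have "B ^ K \<le> (B ^ K) ^ (B ^ k)" using pos by (intro self_le_power) auto
      moreover have "(2::nat) ^ Suc (B ^ k) \<le> 2 ^ (2 * B ^ k)"
        using pos by (intro power_increasing) auto
      ultimately have "B ^ K * 2 ^ Suc (B ^ k) \<le> (B ^ K) ^ (B ^ k) * 2 ^ (2 * B ^ k)"
        by (rule mult_le_mono)
      also have "\<dots> = (4 * B ^ K) ^ (B ^ k)"
        by (simp only: power_mult power_mult_distrib mult.commute) simp
      finally show "B ^ K * 2 ^ Suc (B ^ k) \<le> (4 * B ^ K) ^ (B ^ k)" .
    qed simp
    also have "\<dots> = (4 * B ^ K) ^ (B ^ (K - 1))" by (simp only: power_mult[symmetric] K)
    finally show ?thesis .
  qed
  have "colors_in (multicol K B) S \<subseteq> PiE {..<K} ?C"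
    unfolding colors_in_def multicol_def by fastforce
  then have "card (colors_in (multicol K B) S) \<le> card (PiE {..<K} ?C)"
    using fS by (intro card_mono finite_PiE) auto
  also have "\<dots> = (\<Prod>k<K. card (?C k))" by (simp add: card_PiE)
  also have "\<dots> \<le> (\<Prod>k<K. (4 * B ^ K) ^ (B ^ (K - 1)))" using one by (intro prod_mono) auto
  also have "\<dots> = (4 * B ^ K) ^ (K * B ^ (K - 1))"
    by (simp only: prod_constant card_lessThan power_mult[symmetric] mult.commute[of K])
  finally show ?thesis .
qed

text \<open>The coordinate at a separated scale already shows enough colours. In the case of
  equality, projecting to it merges no colours of \<open>S\<close>, so its leftover structure is one
  for the product.\<close>

lemma multicol_leftover:
  assumes "finite S" "S \<noteq> {}" "card S ^ 4 < K" "S \<subseteq> {..<2 ^ j}"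
  shows "card S \<le> card (colors_in (multicol K B) S) + 1"
    and "card S = card (colors_in (multicol K B) S) + 1 \<Longrightarrow> leftover (multicol K B) S"
proof -
  obtain k where k: "k < K" "separated (B ^ k) (B ^ Suc k) S"
    using exists_separated_scale assms by blast
  let ?f = "ecol (B ^ k) (B ^ Suc k)"
  have f: "?f e = (\<lambda>F. F k) (multicol K B e)" for e using k by (simp add: multicol_def)
  have cf: "colors_in ?f S = (\<lambda>F. F k) ` colors_in (multicol K B) S"
    by (rule colors_in_transfer) (rule f)
  have le: "card (colors_in ?f S) \<le> card (colors_in (multicol K B) S)"
    unfolding cf using assms(1) by (intro card_image_le) simp
  have main: "card S \<le> card (colors_in ?f S) + 1 \<and>
    (card S = card (colors_in ?f S) + 1 \<longrightarrow> leftover ?f S)"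
    by (rule separated_colors[OF _ assms(1,2,4) k(2)]) simp
  then show "card S \<le> card (colors_in (multicol K B) S) + 1" using le by linarith
  assume "card S = card (colors_in (multicol K B) S) + 1"
  then have eq: "card (colors_in ?f S) = card (colors_in (multicol K B) S)" and "leftover ?f S"
    using main le by auto
  show "leftover (multicol K B) S"
  proof (rule leftover_refine[OF \<open>leftover ?f S\<close>])
    show "inj_on (\<lambda>F. F k) (colors_in (multicol K B) S)"
      using eq assms(1) unfolding cf by (intro eq_card_imp_inj_on) auto
  qed (rule f)
qed

section \<open>Choice of the block ratio and asymptotics\<close>

text \<open>Strings of \<open>B ^ K\<close> bits must suffice to name \<open>n\<close> vertices;
  minimality bounds \<open>n\<close> from below by a power of 2.\<close>

definition base :: "nat \<Rightarrow> nat \<Rightarrow> nat" where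
  "base K n = (LEAST B. B \<ge> 2 \<and> n \<le> 2 ^ (B ^ K))"

lemma base:
  assumes "K > 0" shows "base K n \<ge> 2" "n \<le> 2 ^ (base K n ^ K)"
proof -
  have "n \<le> (n + 2) ^ K" using assms self_le_power[of "n + 2" K] by simp
  also have "\<dots> < 2 ^ ((n + 2) ^ K)" by (rule less_exp)
  finally have "n + 2 \<ge> 2 \<and> n \<le> 2 ^ ((n + 2) ^ K)" by simp
  from LeastI[of "\<lambda>B. B \<ge> 2 \<and> n \<le> 2 ^ (B ^ K)", OF this]
  show "base K n \<ge> 2" "n \<le> 2 ^ (base K n ^ K)" unfolding base_def by auto
qed

text \<open>A value above 2 makes \<open>base K n - 1\<close> an admissible competitor, so it must
  fail to accommodate \<open>n\<close>.\<close>

lemma base_minimal: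
  assumes "base K n > 2" shows "2 ^ ((base K n - 1) ^ K) < n"
  using not_less_Least[of "base K n - 1" "\<lambda>B. B \<ge> 2 \<and> n \<le> 2 ^ (B ^ K)"] assms
  unfolding base_def by auto

lemma base_at_top:
  assumes "K > 0" shows "filterlim (base K) at_top sequentially"
  unfolding filterlim_at_top
proof
  fix Z
  show "eventually (\<lambda>n. Z \<le> base K n) sequentially"
    using eventually_gt_at_top[of "2 ^ (Z ^ K)"]
  proof eventually_elim
    case (elim n)
    show ?case
    proof (rule ccontr)
      assume "\<not> Z \<le> base K n"
      then have "(2::nat) ^ (base K n ^ K) \<le> 2 ^ (Z ^ K)"
        by (intro power_increasing power_mono) auto
      then show False using elim base(2)[OF assms, of n] by linarith
    qed
  qed
qed

text \<open>After taking logarithms, \<open>K * B ^ (K - 1) * (ln 4 + K * ln B)\<close> faces a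
  constant times \<open>(B - 1) ^ K\<close>, and \<open>ln B / B\<close> tends to 0.\<close>

lemma color_bound_subpolynomial:
  fixes \<epsilon> :: real
  assumes "K > 0" "\<epsilon> > 0"
  shows "eventually (\<lambda>B. real ((4 * B ^ K) ^ (K * B ^ (K - 1))) \<le> (2 ^ ((B - 1) ^ K)) powr \<epsilon>) sequentially"
proof -
  \<comment> \<open>The factor \<open>2 ^ K\<close> pays for replacing \<open>B - 1\<close> by the
    smaller \<open>B / 2\<close>, valid for \<open>B \<ge> 2\<close>.\<close>
  define \<delta> where "\<delta> = \<epsilon> * ln 2 / 2 ^ K"
  have "\<delta> > 0" using assms by (simp add: \<delta>_def)
  have "((\<lambda>x::real. real K * ln 4 * inverse x + real K * real K * (ln x / x)) \<longlongrightarrow>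
      real K * ln 4 * 0 + real K * real K * 0) at_top"
    by (intro tendsto_intros tendsto_inverse_0_at_top filterlim_ident ln_x_over_x_tendsto_0)
  then have "((\<lambda>B. real K * ln 4 * inverse (real B) + real K * real K * (ln (real B) / real B))
      \<longlongrightarrow> 0) sequentially"
    using filterlim_compose[OF _ filterlim_real_sequentially] by fastforce
  then have "eventually (\<lambda>B. real K * ln 4 * inverse (real B) + real K * real K * (ln (real B) / real B) < \<delta>)
      sequentially"
    using \<open>\<delta> > 0\<close> by (rule order_tendstoD)
  then show ?thesis
    using eventually_ge_at_top[of 2]
  proof eventually_elim
    case (elim B)
    then have B: "real B \<ge> 2" by simp
    have BK: "real B ^ K = real B ^ (K - 1) * real B"
      using power_minus_mult[OF assms(1), of "real B"] by simp
    have "real K * (ln 4 + real K * ln (real B)) = real B *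
       (real K * ln 4 * inverse (real B) + real K * real K * (ln (real B) / real B))"
      using B by (simp add: field_simps)
    also have "\<dots> \<le> real B * \<delta>" using elim(1) B by (intro mult_left_mono) auto
    finally have "real B ^ (K - 1) * (real K * (ln 4 + real K * ln (real B))) \<le>
       real B ^ (K - 1) * (real B * \<delta>)"
      by (intro mult_left_mono) auto
    also have "\<dots> = \<epsilon> * ln 2 * (real B / 2) ^ K"
      by (simp add: \<delta>_def BK power_divide)
    also have "\<dots> \<le> \<epsilon> * ln 2 * (real B - 1) ^ K"
      using assms B by (intro mult_left_mono power_mono) auto
    finally have le: "real (K * B ^ (K - 1)) * (ln 4 + real K * ln (real B))
       \<le> \<epsilon> * (real ((B - 1) ^ K) * ln 2)"
      using elim(2) by (simp add: of_nat_diff mult_ac)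
    have "real ((4 * B ^ K) ^ (K * B ^ (K - 1))) =
       exp (ln (real ((4 * B ^ K) ^ (K * B ^ (K - 1)))))"
      using B by simp
    also have "ln (real ((4 * B ^ K) ^ (K * B ^ (K - 1)))) =
       real (K * B ^ (K - 1)) * (ln 4 + real K * ln (real B))"
      using B by (simp add: ln_realpow ln_mult algebra_simps)
    also have "exp \<dots> \<le> exp (\<epsilon> * ln (2 ^ ((B - 1) ^ K)))"
      using le by (simp add: ln_realpow)
    also have "\<dots> = (2 ^ ((B - 1) ^ K)) powr \<epsilon>" by (simp add: powr_def)
    finally show ?case .
  qed
qed

section \<open>Coding the product colours by natural numbers\<close>

theorem theorem1p1:
  fixes p :: nat
  assumes "p \<ge> 3"
  shows "\<exists>\<chi> :: nat \<Rightarrow> nat set \<Rightarrow> nat.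
    (\<forall>\<epsilon>>0. \<forall>\<^sub>F n in sequentially.
        real (card (colors_in (\<chi> n) {0..<n})) \<le> real n powr \<epsilon>) \<and>
    (\<forall>n. \<forall>S. S \<subseteq> {0..<n} \<and> card S = p \<longrightarrow> card (colors_in (\<chi> n) S) \<ge> p - 1) \<and>
    (\<forall>n. \<forall>S. S \<subseteq> {0..<n} \<and> card S = p \<and> card (colors_in (\<chi> n) S) = p - 1
        \<longrightarrow> leftover (\<chi> n) S)"
proof -
  \<comment> \<open>Just above the \<open>p ^ 4\<close> scales that a set of \<open>p\<close>
    vertices can spoil.\<close>
  define K where "K = p ^ 4 + 1"
  have "K > 0" by (simp add: K_def)
  note base = base[OF \<open>K > 0\<close>]
  define F where "F n = multicol K (base K n)" for n
  \<comment> \<open>For each \<open>n\<close> only finitely many colours occur, so they can be coded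
    injectively.\<close>
  have "\<exists>\<phi> :: _ \<Rightarrow> nat. inj_on \<phi> (colors_in (F n) {0..<n})" for n
    using finite_imp_inj_to_nat_seg[of "colors_in (F n) {0..<n}"] by auto
  then obtain \<phi> :: "nat \<Rightarrow> _ \<Rightarrow> nat" where \<phi>: "\<And>n. inj_on (\<phi> n) (colors_in (F n) {0..<n})"
    by metis
  define \<chi> where "\<chi> n e = \<phi> n (F n e)" for n e
  have col: "colors_in (\<chi> n) S = \<phi> n ` colors_in (F n) S" for n S
    by (rule colors_in_transfer) (simp add: \<chi>_def)
  have inj: "inj_on (\<phi> n) (colors_in (F n) S)" if "S \<subseteq> {0..<n}" for n S
    by (rule inj_on_subset[OF \<phi> colors_in_mono[OF that]])
  have card_col: "card (colors_in (\<chi> n) S) = card (colors_in (F n) S)" if "S \<subseteq> {0..<n}" for n S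
    unfolding col by (rule card_image[OF inj[OF that]])
  have S: "finite S" "S \<noteq> {}" "card S ^ 4 < K" "S \<subseteq> {..<2 ^ (base K n ^ K)}"
    if "S \<subseteq> {0..<n}" "card S = p" for n S
  proof -
    show "finite S" using that finite_subset by blast
    show "S \<noteq> {}" using that assms by auto
    show "card S ^ 4 < K" using that by (simp add: K_def)
    show "S \<subseteq> {..<2 ^ (base K n ^ K)}" using that base(2)[of n] by fastforce
  qed
  show ?thesis
  proof (intro exI[of _ \<chi>] conjI allI impI)
    fix \<epsilon> :: real assume "\<epsilon> > 0"
    have "eventually (\<lambda>n. real ((4 * base K n ^ K) ^ (K * base K n ^ (K - 1)))
        \<le> (2 ^ ((base K n - 1) ^ K)) powr \<epsilon>) sequentially"
      using color_bound_subpolynomial[OF \<open>K > 0\<close> \<open>\<epsilon> > 0\<close>] base_at_top[OF \<open>K > 0\<close>]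
      by (rule eventually_compose_filterlim)
    \<comment> \<open>This makes \<open>base_minimal\<close> applicable, which turns the bound in
      terms of the base into one in terms of \<open>n\<close>.\<close>
    moreover have "eventually (\<lambda>n. base K n \<ge> 3) sequentially"
      using base_at_top[OF \<open>K > 0\<close>] by (simp add: filterlim_at_top)
    ultimately show "eventually (\<lambda>n. real (card (colors_in (\<chi> n) {0..<n})) \<le> real n powr \<epsilon>) sequentially"
    proof eventually_elim
      case (elim n)
      have "{0..<n} \<subseteq> {..<2 ^ (base K n ^ K)}" using base(2)[of n] by fastforce
      then have "card (colors_in (\<chi> n) {0..<n}) \<le> (4 * base K n ^ K) ^ (K * base K n ^ (K - 1))"
        using card_col card_colors_multicol[OF base(1) \<open>K > 0\<close>] unfolding F_def by auto
      then have "real (card (colors_in (\<chi> n) {0..<n})) \<le> (2 ^ ((base K n - 1) ^ K)) powr \<epsilon>"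
        using elim(1) by linarith
      also have "\<dots> \<le> real n powr \<epsilon>"
      proof (rule powr_mono2)
        have "real (2 ^ ((base K n - 1) ^ K)) \<le> real n"
          using base_minimal[of K n] elim(2) by (intro of_nat_mono) simp
        then show "(2 ^ ((base K n - 1) ^ K)) \<le> real n" by simp
      qed (use \<open>\<epsilon> > 0\<close> in auto)
      finally show ?case .
    qed
  next
    fix n :: nat and S :: "nat set" assume "S \<subseteq> {0..<n} \<and> card S = p"
    then have *: "S \<subseteq> {0..<n}" "card S = p" by auto
    then show "card (colors_in (\<chi> n) S) \<ge> p - 1"
      using multicol_leftover(1)[OF S[OF *], of "base K n"] card_col[OF *(1)] by (simp add: F_def)
  next
    fix n :: nat and S :: "nat set" assume *: "S \<subseteq> {0..<n} \<and> card S = p \<and> card (colors_in (\<chi> n) S) = p - 1"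
    then have Sn: "S \<subseteq> {0..<n}" "card S = p" by auto
    have "card S = card (colors_in (F n) S) + 1"
      using card_col[OF Sn(1)] * assms by simp
    then have "leftover (F n) S"
      using multicol_leftover(2)[OF S[OF Sn], of "base K n"] by (simp add: F_def)
    \<comment> \<open>\<open>leftover_refine\<close> needs the known colouring as a function of the
      new one, hence the inverse of the coding.\<close>
    then show "leftover (\<chi> n) S"
    proof (rule leftover_refine[where \<phi> = "inv_into (colors_in (F n) {0..<n}) (\<phi> n)"])
      fix a b assume ab: "a \<in> S" "b \<in> S" "a \<noteq> b"
      have "F n {a, b} \<in> colors_in (F n) {0..<n}"
        using ab * by (intro colors_inI) auto
      then show "F n {a, b} = inv_into (colors_in (F n) {0..<n}) (\<phi> n) (\<chi> n {a, b})"
        unfolding \<chi>_def by (simp add: inv_into_f_f[OF \<phi>])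
    next
      show "inj_on (inv_into (colors_in (F n) {0..<n}) (\<phi> n)) (colors_in (\<chi> n) S)"
        unfolding col using * by (intro inj_on_inv_into image_mono colors_in_mono) simp
    qed
  qed
qed

end
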